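(* Let $X$ be an almost transitive real Banach space. Suppose that for some $x_0\in S_X$, with support functional $\phi$, the group $\mathrm{Stab}_{x_0}(X)$ acts almost transitively on $S_{\operatorname{Ker}\phi}$, the unit sphere of $\operatorname{Ker}\phi$. Then $X$ is isometric to a Hilbert space.
   Context: $S_X=\{x\in X:\|x\|=1\}$. $\mathrm{Isom}(X)$ is the group of linear surjective isometries of $X$. $X$ is almost transitive if for all $x,y\in S_X$ and $\varepsilon>0$ there is $T\in\mathrm{Isom}(X)$ with $\|y-Tx\|\leq\varepsilon$. A support functional of $x_0\in S_X$ is $\phi\in X^*$ with $\|\phi\|=1=\phi(x_0)$. $\mathrm{Stab}_{x_0}(X)=\{T\in\mathrm{Isom}(X):Tx_0=x_0\}$. That $\mathrm{Stab}_{x_0}(X)$ acts almost transitively on $S_{\operatorname{Ker}\phi}=S_X\cap\operatorname{Ker}\phi$ means that its elements leave $\operatorname{Ker}\phi$ invariant (so that the group acts on $S_{\operatorname{Ker}\phi}$) and that the orbits are dense: for all $y,z\in S_{\operatorname{Ker}\phi}$ and $\varepsilon>0$ there is $T\in\mathrm{Stab}_{x_0}(X)$ with $\|Ty-z\|\leq\varepsilon$. *)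

theory Defs
  imports "HOL-Analysis.Analysis"
begin

definition Isom :: "('a::real_normed_vector \<Rightarrow> 'a) set" where
  "Isom = {T. linear T \<and> surj T \<and> (\<forall>x. norm (T x) = norm x)}"

definition almost_transitive :: "'a::real_normed_vector itself \<Rightarrow> bool" where
  "almost_transitive _ \<longleftrightarrow>
     (\<forall>x\<in>sphere (0::'a) 1. \<forall>y\<in>sphere 0 1. \<forall>e>0. \<exists>T\<in>Isom. norm (y - T x) \<le> e)"

definition support_functional :: "('a::real_normed_vector \<Rightarrow>\<^sub>L real) \<Rightarrow> 'a \<Rightarrow> bool" where
  "support_functional \<phi> x \<longleftrightarrow> norm \<phi> = 1 \<and> blinfun_apply \<phi> x = 1"

definition Ker :: "('a::real_normed_vector \<Rightarrow>\<^sub>L real) \<Rightarrow> 'a set" where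
  "Ker \<phi> = {x. blinfun_apply \<phi> x = 0}"

definition Stab :: "'a::real_normed_vector \<Rightarrow> ('a \<Rightarrow> 'a) set" where
  "Stab x = {T \<in> Isom. T x = x}"

definition acts_almost_transitively_on_sphere ::
    "('a::real_normed_vector \<Rightarrow> 'a) set \<Rightarrow> 'a set \<Rightarrow> bool" where
  "acts_almost_transitively_on_sphere G V \<longleftrightarrow>
     (\<forall>T\<in>G. T ` V \<subseteq> V) \<and>
     (\<forall>y\<in>sphere 0 1 \<inter> V. \<forall>z\<in>sphere 0 1 \<inter> V. \<forall>e>0. \<exists>T\<in>G. norm (T y - z) \<le> e)"

definition inner_product_on :: "'v::real_vector set \<Rightarrow> ('v \<Rightarrow> 'v \<Rightarrow> real) \<Rightarrow> bool" where
  "inner_product_on H ip \<longleftrightarrow>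
     (\<forall>x\<in>H. \<forall>y\<in>H. ip x y = ip y x) \<and>
     (\<forall>x\<in>H. \<forall>y\<in>H. \<forall>z\<in>H. ip (x + y) z = ip x z + ip y z) \<and>
     (\<forall>c. \<forall>x\<in>H. \<forall>y\<in>H. ip (c *\<^sub>R x) y = c * ip x y) \<and>
     (\<forall>x\<in>H. 0 \<le> ip x x) \<and>
     (\<forall>x\<in>H. ip x x = 0 \<longrightarrow> x = 0)"

definition hilbert_space_on :: "'v::real_vector set \<Rightarrow> ('v \<Rightarrow> 'v \<Rightarrow> real) \<Rightarrow> bool" where
  "hilbert_space_on H ip \<longleftrightarrow>
     subspace H \<and> inner_product_on H ip \<and>
     Metric_space.mcomplete H (\<lambda>x y. sqrt (ip (x - y) (x - y)))"

text \<open>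
  HOL cannot quantify existentially over types, so the Hilbert space is sought among the
  real vector spaces carried by linear subspaces of the type \<^typ>\<open>'a\<close> itself, with an
  arbitrary inner product.  This is no restriction: a Hilbert space isometric to \<^typ>\<open>'a\<close>
  is in particular linearly isomorphic to it, so that it has a copy of this form.
\<close>

definition isometric_to_hilbert_space :: "'a::real_normed_vector itself \<Rightarrow> bool" where
  "isometric_to_hilbert_space _ \<longleftrightarrow>
     (\<exists>(H :: 'a set) ip (J :: 'a \<Rightarrow> 'a).
        hilbert_space_on H ip \<and> linear J \<and> range J = H \<and>
        (\<forall>x. sqrt (ip (J x) (J x)) = norm x))"

end

theory Submission
  imports Defs
begin

text \<open>
  Fix \<open>y0\<close> in the unit sphere of \<open>Ker \<phi>\<close>.  The stabiliser hypothesis says that the norm of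
  \<open>a x0 + k\<close>, \<open>k \<in> Ker \<phi>\<close>, depends only on \<open>a\<close> and \<open>\<parallel>k\<parallel>\<close>, and almost transitivity, after passing
  to a limit, that any pair \<open>(x, w)\<close> with \<open>x\<close> a unit vector is carried by a linear isometry of its
  span into the plane \<open>E\<close> of \<open>x0\<close> and \<open>y0\<close>, with \<open>x\<close> going to \<open>x0\<close>.  So \<open>E\<close> has a transitive
  isometry group.  Among the quadratic forms dominated by the squared norm of \<open>E\<close> the one of
  largest determinant is unique, hence invariant under isometries, hence a multiple of the squared
  norm.  Thus all planes in the space are Euclidean and the Jordan--von Neumann argument applies.
\<close>

section \<open>Binary quadratic forms and their determinants\<close>

text \<open>A triple \<open>(A, B, C)\<close> is the symmetric matrix with diagonal
  \<open>A\<close>, \<open>C\<close> and off-diagonal entry \<open>B\<close>; sums, scaling and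
  topology come from the product type.\<close>

definition qform :: "real \<times> real \<times> real \<Rightarrow> real \<Rightarrow> real \<Rightarrow> real" where
  "qform Q a b = fst Q * a\<^sup>2 + 2 * fst (snd Q) * a * b + snd (snd Q) * b\<^sup>2"

definition qdet :: "real \<times> real \<times> real \<Rightarrow> real" where
  "qdet Q = fst Q * snd (snd Q) - (fst (snd Q))\<^sup>2"

text \<open>The pullback of \<open>Q\<close> along the matrix with rows
  \<open>(\<alpha>, \<beta>)\<close> and \<open>(\<gamma>, \<delta>)\<close>.\<close>

definition qcomp :: "real \<times> real \<times> real \<Rightarrow> real \<Rightarrow> real \<Rightarrow> real \<Rightarrow> real \<Rightarrow> real \<times> real \<times> real" where
  "qcomp Q \<alpha> \<beta> \<gamma> \<delta> =
     (qform Q \<alpha> \<gamma>,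
      fst Q * \<alpha> * \<beta> + fst (snd Q) * (\<alpha> * \<delta> + \<beta> * \<gamma>) + snd (snd Q) * \<gamma> * \<delta>,
      qform Q \<beta> \<delta>)"

text \<open>Semidefiniteness is expressed by the principal minors, with weak inequalities to keep
  the set closed. If \<open>N\<close> is a norm, the definite forms here are the ellipses around its
  unit ball; maximal determinant means minimal area, which is the Loewner ellipse.\<close>

definition dominated_forms :: "(real \<Rightarrow> real \<Rightarrow> real) \<Rightarrow> (real \<times> real \<times> real) set" where
  "dominated_forms N = {Q. 0 \<le> fst Q \<and> 0 \<le> snd (snd Q) \<and> 0 \<le> qdet Q \<and> (\<forall>a b. qform Q a b \<le> (N a b)\<^sup>2)}"

lemma qform_qcomp: "qform (qcomp Q \<alpha> \<beta> \<gamma> \<delta>) a b = qform Q (\<alpha> * a + \<beta> * b) (\<gamma> * a + \<delta> * b)"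
  unfolding qform_def qcomp_def by (simp add: power2_eq_square algebra_simps)

lemma qdet_qcomp: "qdet (qcomp Q \<alpha> \<beta> \<gamma> \<delta>) = (\<alpha> * \<delta> - \<beta> * \<gamma>)\<^sup>2 * qdet Q"
  unfolding qdet_def qform_def qcomp_def by (simp add: power2_eq_square algebra_simps)

lemma qform_nonneg:
  assumes "0 \<le> fst Q" "0 \<le> snd (snd Q)" "0 \<le> qdet Q"
  shows "0 \<le> qform Q a b"
proof (cases "fst Q = 0")
  case True
  then have "fst (snd Q) = 0"
    using assms unfolding qdet_def by simp
  with True assms show ?thesis by (simp add: qform_def)
next
  case False
  have "fst Q * qform Q a b = (fst Q * a + fst (snd Q) * b)\<^sup>2 + qdet Q * b\<^sup>2"
    unfolding qform_def qdet_def by (simp add: power2_eq_square algebra_simps)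
  also have "\<dots> \<ge> 0" using assms by simp
  finally show ?thesis using False assms by (simp add: zero_le_mult_iff)
qed

text \<open>The equality case of Minkowski's determinant inequality.\<close>

lemma eq_if_qdet_add_le:
  assumes D: "D > 0" "qdet P = D" "qdet Q = D" and pos: "fst P > 0" "fst Q > 0"
    and le: "qdet (P + Q) \<le> 4 * D"
  shows "P = Q"
proof -
  obtain A B C where P: "P = (A, B, C)" by (cases P)
  obtain A' B' C' where Q: "Q = (A', B', C')" by (cases Q)
  have A: "A > 0" "A' > 0" using pos P Q by auto
  have 1: "A * C - B\<^sup>2 = D" "A' * C' - B'\<^sup>2 = D" using D P Q by (auto simp: qdet_def)
  have "(A + A') * (C + C') - (B + B')\<^sup>2 \<le> 4 * D"
    using le P Q by (simp add: qdet_def)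
  then have "A * C' + A' * C - 2 * B * B' - 2 * D \<le> 0"
    using 1 by (simp add: power2_eq_square algebra_simps)
  then have "A * A' * (A * C' + A' * C - 2 * B * B' - 2 * D) \<le> 0"
    using A by (simp add: mult_nonneg_nonpos)
  \<comment> \<open>The factor \<open>A * A'\<close> turns the excess of the mixed discriminant over
    \<open>2 * D\<close> into a sum of squares, so both squares vanish.\<close>
  moreover have "A * A' * (A * C' + A' * C - 2 * B * B' - 2 * D) =
      D * (A - A')\<^sup>2 + (A * B' - A' * B)\<^sup>2"
  proof -
    have "A * A' * (A * C' + A' * C - 2 * B * B' - 2 * D) =
        A\<^sup>2 * (A' * C') + A'\<^sup>2 * (A * C) - 2 * A * A' * B * B' - 2 * A * A' * D"
      by (simp add: power2_eq_square algebra_simps)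
    also have "\<dots> = A\<^sup>2 * (D + B'\<^sup>2) + A'\<^sup>2 * (D + B\<^sup>2) - 2 * A * A' * B * B' - 2 * A * A' * D"
      using 1 by (metis add.commute diff_add_cancel)
    also have "\<dots> = D * (A - A')\<^sup>2 + (A * B' - A' * B)\<^sup>2"
      by (simp add: power2_eq_square algebra_simps)
    finally show ?thesis .
  qed
  moreover have "D * (A - A')\<^sup>2 \<ge> 0" "(A * B' - A' * B)\<^sup>2 \<ge> 0" using D by auto
  ultimately have "D * (A - A')\<^sup>2 = 0" "(A * B' - A' * B)\<^sup>2 = 0" by linarith+
  then have "A = A'" "A * B' = A' * B" using D by auto
  then have "B = B'" using A by simp
  then have "A * C = A * C'" using 1 \<open>A = A'\<close> by (metis diff_add_cancel)
  then show ?thesis using P Q A \<open>A = A'\<close> \<open>B = B'\<close> by simp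
qed

lemma dominated_forms_qcomp:
  assumes "Q \<in> dominated_forms N" "\<And>a b. N (\<alpha> * a + \<beta> * b) (\<gamma> * a + \<delta> * b) = N a b"
  shows "qcomp Q \<alpha> \<beta> \<gamma> \<delta> \<in> dominated_forms N"
proof -
  have Q: "0 \<le> fst Q" "0 \<le> snd (snd Q)" "0 \<le> qdet Q" "\<And>a b. qform Q a b \<le> (N a b)\<^sup>2"
    using assms(1) by (auto simp: dominated_forms_def)
  have "0 \<le> fst (qcomp Q \<alpha> \<beta> \<gamma> \<delta>)" "0 \<le> snd (snd (qcomp Q \<alpha> \<beta> \<gamma> \<delta>))"
    using qform_nonneg[OF Q(1-3)] by (simp_all add: qcomp_def)
  moreover have "qform (qcomp Q \<alpha> \<beta> \<gamma> \<delta>) a b \<le> (N a b)\<^sup>2" for a b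
    using Q(4)[of "\<alpha> * a + \<beta> * b" "\<gamma> * a + \<delta> * b"] assms(2)[of a b] by (simp add: qform_qcomp)
  ultimately show ?thesis
    using Q(3) by (simp add: dominated_forms_def qdet_qcomp)
qed

text \<open>Domination at the two basis vectors bounds the diagonal entries, and the nonnegative
  determinant then bounds the off-diagonal one. Compactness will supply a form of maximal
  determinant.\<close>

lemma compact_dominated_forms: "compact (dominated_forms N)"
proof -
  have "dominated_forms N = {Q. 0 \<le> fst Q} \<inter> {Q. 0 \<le> snd (snd Q)} \<inter> {Q. 0 \<le> qdet Q} \<inter>
      (\<Inter>a. \<Inter>b. {Q. qform Q a b \<le> (N a b)\<^sup>2})"
    by (auto simp: dominated_forms_def)
  also have "closed \<dots>"
    unfolding qdet_def qform_def
    by (intro closed_Int closed_INT ballI closed_Collect_le continuous_intros)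
  finally have closed: "closed (dominated_forms N)" .
  define M where "M = (N 1 0)\<^sup>2 + (N 0 1)\<^sup>2"
  have "dominated_forms N \<subseteq> {0..M} \<times> {-M..M} \<times> {0..M}"
  proof
    fix Q assume "Q \<in> dominated_forms N"
    then have Q: "0 \<le> fst Q" "0 \<le> snd (snd Q)" "0 \<le> qdet Q" "\<And>a b. qform Q a b \<le> (N a b)\<^sup>2"
      by (auto simp: dominated_forms_def)
    have "fst Q \<le> (N 1 0)\<^sup>2" "snd (snd Q) \<le> (N 0 1)\<^sup>2"
      using Q(4)[of 1 0] Q(4)[of 0 1] by (auto simp: qform_def)
    then have le: "fst Q \<le> M" "snd (snd Q) \<le> M"
      unfolding M_def by (smt (verit) zero_le_power2)+
    have "(fst (snd Q))\<^sup>2 \<le> fst Q * snd (snd Q)" using Q(3) by (simp add: qdet_def)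
    also have "\<dots> \<le> M * M" using le Q(1,2) by (intro mult_mono) auto
    finally have "\<bar>fst (snd Q)\<bar> \<le> M"
      using le Q(1) by (metis abs_le_square_iff abs_of_nonneg order_trans power2_eq_square)
    then show "Q \<in> {0..M} \<times> {-M..M} \<times> {0..M}"
      using Q le by (auto simp: mem_Times_iff)
  qed
  moreover have "bounded ({0..M} \<times> {-M..M} \<times> {0..M})"
    by (intro bounded_Times) auto
  ultimately have "bounded (dominated_forms N)" using bounded_subset by blast
  with closed show ?thesis by (simp add: compact_eq_bounded_closed)
qed

text \<open>Pulling back along the matrix and along its inverse cannot raise the determinant, so the
  pullback is a maximizer too. The midpoint of two maximizers is again dominated, and the equality
  case of Minkowski's inequality identifies them.\<close>

lemma max_dominated_form_invariant:
  assumes Q: "Q \<in> dominated_forms N" "qdet Q > 0"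
    and max: "\<And>P. P \<in> dominated_forms N \<Longrightarrow> qdet P \<le> qdet Q"
    and inv: "\<And>a b. N (\<alpha> * a + \<beta> * b) (\<gamma> * a + \<delta> * b) = N a b"
    and nz: "\<alpha> * \<delta> - \<beta> * \<gamma> \<noteq> 0"
  shows "qcomp Q \<alpha> \<beta> \<gamma> \<delta> = Q"
proof -
  define \<Delta> where "\<Delta> = \<alpha> * \<delta> - \<beta> * \<gamma>"
  have \<Delta>: "\<Delta> \<noteq> 0" using nz \<Delta>_def by simp
  let ?P = "qcomp Q \<alpha> \<beta> \<gamma> \<delta>"
  have P: "?P \<in> dominated_forms N" by (intro dominated_forms_qcomp Q(1) inv)
  from max[OF this] have 1: "\<Delta>\<^sup>2 \<le> 1"
    using Q(2) by (simp add: qdet_qcomp \<Delta>_def mult_le_cancel_right1)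
  \<comment> \<open>The inverse matrix preserves \<open>N\<close> as well; it yields the bound
    opposite to \<open>\<Delta>\<^sup>2 \<le> 1\<close>.\<close>
  have inv': "N (\<delta> / \<Delta> * a + (- \<beta> / \<Delta>) * b) ((- \<gamma> / \<Delta>) * a + \<alpha> / \<Delta> * b) = N a b" for a b
  proof -
    let ?a = "\<delta> / \<Delta> * a + (- \<beta> / \<Delta>) * b" and ?b = "(- \<gamma> / \<Delta>) * a + \<alpha> / \<Delta> * b"
    have "\<alpha> * ?a + \<beta> * ?b = \<Delta> * a / \<Delta>" "\<gamma> * ?a + \<delta> * ?b = \<Delta> * b / \<Delta>"
      unfolding \<Delta>_def by (simp_all add: diff_divide_distrib[symmetric] add_divide_distrib[symmetric] algebra_simps)
    then show ?thesis using inv[of ?a ?b] \<Delta> by simp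
  qed
  have "(\<delta> / \<Delta> * (\<alpha> / \<Delta>) - (- \<beta> / \<Delta>) * (- \<gamma> / \<Delta>)) = \<Delta> / (\<Delta> * \<Delta>)"
    unfolding \<Delta>_def by (simp add: diff_divide_distrib mult.commute)
  then have "(\<delta> / \<Delta> * (\<alpha> / \<Delta>) - (- \<beta> / \<Delta>) * (- \<gamma> / \<Delta>))\<^sup>2 = 1 / \<Delta>\<^sup>2"
    using \<Delta> by (simp add: power_divide)
  moreover have "qcomp Q (\<delta> / \<Delta>) (- \<beta> / \<Delta>) (- \<gamma> / \<Delta>) (\<alpha> / \<Delta>) \<in> dominated_forms N"
    by (intro dominated_forms_qcomp Q(1) inv')
  note max[OF this]
  ultimately have "1 / \<Delta>\<^sup>2 * qdet Q \<le> qdet Q"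
    by (simp add: qdet_qcomp)
  then have "1 \<le> \<Delta>\<^sup>2" using Q(2) \<Delta> by (simp add: field_simps)
  with 1 have "\<Delta>\<^sup>2 = 1" by simp
  then have det: "qdet ?P = qdet Q" by (simp add: qdet_qcomp \<Delta>_def)
  have dom: "0 \<le> fst R" "0 \<le> snd (snd R)" "0 \<le> qdet R" "qform R a b \<le> (N a b)\<^sup>2"
    if "R \<in> dominated_forms N" for R a b
    using that by (auto simp: dominated_forms_def)
  have pos: "fst R > 0" if "R \<in> dominated_forms N" "qdet R > 0" for R
    using dom(1)[OF that(1)] that(2) unfolding qdet_def
    by (metis diff_gt_0_iff_gt less_eq_real_def mult_zero_left not_less zero_le_power2)
  let ?S = "?P + Q"
  have "(1/2) *\<^sub>R ?S \<in> dominated_forms N"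
  proof -
    have h: "qform ((1/2) *\<^sub>R ?S) a b = (qform ?P a b + qform Q a b) / 2" for a b
      unfolding qform_def by (simp add: algebra_simps add_divide_distrib)
    have nn: "qform ((1/2) *\<^sub>R ?S) a b \<ge> 0" for a b
      unfolding h using qform_nonneg[OF dom(1-3)[OF P]] qform_nonneg[OF dom(1-3)[OF Q(1)]] by simp
    have le: "qform ((1/2) *\<^sub>R ?S) a b \<le> (N a b)\<^sup>2" for a b
      unfolding h using dom(4)[OF P, of a b] dom(4)[OF Q(1), of a b] by simp
    define A B C where "A = fst ((1/2) *\<^sub>R ?S)" "B = fst (snd ((1/2) *\<^sub>R ?S))" "C = snd (snd ((1/2) *\<^sub>R ?S))"
    have "A > 0" using pos[OF P] pos[OF Q] det Q(2) by (simp add: A_B_C_def(1))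
    \<comment> \<open>Evaluating the midpoint form at \<open>(B, -A)\<close> gives \<open>A\<close>
      times its determinant.\<close>
    have "0 \<le> A * B\<^sup>2 + 2 * B * B * (-A) + C * A\<^sup>2"
      using nn[of "B" "-A"] unfolding qform_def A_B_C_def[symmetric]
      by (simp add: power2_eq_square algebra_simps)
    also have "\<dots> = A * (A * C - B\<^sup>2)" by (simp add: power2_eq_square algebra_simps)
    finally have "A * C - B\<^sup>2 \<ge> 0" using \<open>A > 0\<close> by (simp add: zero_le_mult_iff)
    then show ?thesis
      using le nn[of 1 0] nn[of 0 1]
      by (auto simp: dominated_forms_def qdet_def qform_def A_B_C_def)
  qed
  from max[OF this] have "qdet ?S \<le> 4 * qdet Q"
    unfolding qdet_def by (simp add: power2_eq_square field_simps)
  then show ?thesis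
    using eq_if_qdet_add_le[OF Q(2) det refl] pos[OF P] pos[OF Q] det Q(2) by simp
qed

section \<open>Carrying arbitrary planes into the plane of \<open>x0\<close> and
  \<open>y0\<close>\<close>

lemma bounded_seq_pair_subseq:
  fixes c s :: "nat \<Rightarrow> real"
  assumes "\<And>n. \<bar>c n\<bar> \<le> M" "\<And>n. \<bar>s n\<bar> \<le> M"
  obtains c' s' r where "strict_mono r" "(c \<circ> r) \<longlonglongrightarrow> c'" "(s \<circ> r) \<longlonglongrightarrow> s'"
proof -
  have "compact ({-M..M} \<times> {-M..M})" by (intro compact_Times) auto
  moreover have "(c n, s n) \<in> {-M..M} \<times> {-M..M}" for n
    using assms[of n] by (auto simp: abs_le_iff)
  ultimately obtain l r where r: "strict_mono r" and l: "((\<lambda>n. (c n, s n)) \<circ> r) \<longlonglongrightarrow> l"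
    using seq_compactE[of "{-M..M} \<times> {-M..M}" "\<lambda>n. (c n, s n)"]
    unfolding compact_eq_seq_compact_metric by metis
  from tendsto_fst[OF l] tendsto_snd[OF l] r show ?thesis
    by (intro that[of r "fst l" "snd l"]) (simp_all add: o_def)
qed

text \<open>An element of \<open>Stab x0\<close> moves \<open>y0\<close> arbitrarily close to
  \<open>k /\<^sub>R norm k\<close> and fixes \<open>x0\<close>, so it carries the right-hand vector
  close to the left-hand one without changing its norm.\<close>

lemma norm_add_Ker_eq:
  assumes act: "acts_almost_transitively_on_sphere (Stab x0) (Ker \<phi>)"
    and y0: "y0 \<in> Ker \<phi>" "norm y0 = 1" and k: "k \<in> Ker \<phi>"
  shows "norm (a *\<^sub>R x0 + k) = norm (a *\<^sub>R x0 + norm k *\<^sub>R y0)"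
proof (cases "k = 0")
  case False
  define y where "y = k /\<^sub>R norm k"
  have ky: "k = norm k *\<^sub>R y" using False by (simp add: y_def)
  have y: "y \<in> Ker \<phi>" "norm y = 1"
    using k False by (auto simp: y_def Ker_def blinfun.scaleR_right)
  have "\<bar>norm (a *\<^sub>R x0 + k) - norm (a *\<^sub>R x0 + norm k *\<^sub>R y0)\<bar> \<le> e" if "e > 0" for e
  proof -
    have "e / norm k > 0" using that False by simp
    then obtain T where T: "T \<in> Stab x0" "norm (T y0 - y) \<le> e / norm k"
      using act y y0 unfolding acts_almost_transitively_on_sphere_def by force
    then have lin: "linear T" and iso: "\<And>x. norm (T x) = norm x" and "T x0 = x0"
      by (auto simp: Stab_def Isom_def)
    have "norm (a *\<^sub>R x0 + norm k *\<^sub>R y0) = norm (T (a *\<^sub>R x0 + norm k *\<^sub>R y0))"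
      by (simp add: iso)
    also have "\<dots> = norm (a *\<^sub>R x0 + norm k *\<^sub>R T y0)"
      using lin \<open>T x0 = x0\<close> by (simp add: linear_add linear_scale)
    finally have "\<bar>norm (a *\<^sub>R x0 + k) - norm (a *\<^sub>R x0 + norm k *\<^sub>R y0)\<bar> \<le>
        norm ((a *\<^sub>R x0 + k) - (a *\<^sub>R x0 + norm k *\<^sub>R T y0))"
      using norm_triangle_ineq3 by metis
    also have "(a *\<^sub>R x0 + k) - (a *\<^sub>R x0 + norm k *\<^sub>R T y0) = norm k *\<^sub>R (y - T y0)"
      by (subst ky) (simp add: algebra_simps)
    also have "norm \<dots> = norm k * norm (T y0 - y)" by (simp add: norm_minus_commute)
    also have "\<dots> \<le> e" using T(2) False by (simp add: field_simps)
    finally show ?thesis .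
  qed
  then show ?thesis
    by (metis abs_ge_zero abs_le_zero_iff eq_iff_diff_eq_0 field_le_epsilon add_0)
qed simp

text \<open>Isometries \<open>T n\<close> take \<open>x\<close> to vectors tending to
  \<open>x0\<close>. The vectors \<open>T n w\<close> need not converge, but the norms involved
  depend on them only through two bounded scalars, and these converge along a subsequence.\<close>

lemma norm_plane_eq:
  fixes x0 x w :: "'a::real_normed_vector"
  assumes at: "almost_transitive TYPE('a)"
    and x0: "norm x0 = 1" and supp: "support_functional \<phi> x0"
    and act: "acts_almost_transitively_on_sphere (Stab x0) (Ker \<phi>)"
    and y0: "y0 \<in> Ker \<phi>" "norm y0 = 1" and x: "norm x = 1"
  obtains c s where
    "\<And>a b. norm (a *\<^sub>R x + b *\<^sub>R w) = norm ((a + b * c) *\<^sub>R x0 + (b * s) *\<^sub>R y0)"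
proof -
  have "\<exists>T\<in>Isom. norm (x0 - T x) \<le> 1 / real (Suc n)" for n
    using at x x0 unfolding almost_transitive_def by simp
  then obtain T where T: "\<And>n. T n \<in> Isom" "\<And>n. norm (x0 - T n x) \<le> 1 / real (Suc n)"
    by metis
  have lin: "\<And>n. linear (T n)" and iso: "\<And>n x. norm (T n x) = norm x"
    using T(1) by (auto simp: Isom_def)
  \<comment> \<open>Splitting \<open>T n w\<close> along \<open>x0\<close> and
    \<open>Ker \<phi>\<close>; the limits of \<open>c n\<close> and \<open>norm (k n)\<close> become
    the coefficients \<open>c\<close> and \<open>s\<close>.\<close>
  define c where "c n = blinfun_apply \<phi> (T n w)" for n
  define k where "k n = T n w - c n *\<^sub>R x0" for n
  have \<phi>: "norm \<phi> = 1" "blinfun_apply \<phi> x0 = 1"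
    using supp by (auto simp: support_functional_def)
  have c: "\<bar>c n\<bar> \<le> norm w" for n
    using norm_blinfun[of \<phi> "T n w"] by (simp add: c_def \<phi> iso)
  have "norm (k n) \<le> norm w + norm w" for n
    using norm_triangle_ineq4[of "T n w" "c n *\<^sub>R x0"] c[of n] by (simp add: k_def iso x0)
  then obtain c' s r where r: "strict_mono r"
    and lim: "(c \<circ> r) \<longlonglongrightarrow> c'" "((\<lambda>n. norm (k n)) \<circ> r) \<longlonglongrightarrow> s"
    using bounded_seq_pair_subseq[of c "norm w + norm w" "\<lambda>n. norm (k n)"] c
    by (metis abs_norm_cancel add_increasing norm_ge_zero)
  have kKer: "k n \<in> Ker \<phi>" for n
    by (simp add: k_def Ker_def blinfun.diff_right blinfun.scaleR_right \<phi> c_def)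
  have Tx: "(\<lambda>n. T n x) \<longlonglongrightarrow> x0"
  proof (rule LIM_zero_cancel, rule Lim_null_comparison)
    show "\<forall>\<^sub>F n in sequentially. norm (T n x - x0) \<le> 1 / real (Suc n)"
      using T(2) by (simp add: norm_minus_commute)
    show "(\<lambda>n. 1 / real (Suc n)) \<longlonglongrightarrow> 0"
      using LIMSEQ_inverse_real_of_nat by (simp add: inverse_eq_divide)
  qed
  show ?thesis
  proof (rule that)
    fix a b
    have eq: "norm (a *\<^sub>R x0 + b *\<^sub>R T n w) = norm ((a + b * c n) *\<^sub>R x0 + (b * norm (k n)) *\<^sub>R y0)" for n
    proof -
      have "a *\<^sub>R x0 + b *\<^sub>R T n w = (a + b * c n) *\<^sub>R x0 + b *\<^sub>R k n"
        by (simp add: k_def algebra_simps)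
      \<comment> \<open>Both kernel vectors have norm \<open>\<bar>b\<bar> * norm (k n)\<close>;
        comparing each with that multiple of \<open>y0\<close> covers negative
        \<open>b\<close>.\<close>
      moreover have "b *\<^sub>R k n \<in> Ker \<phi>" "(b * norm (k n)) *\<^sub>R y0 \<in> Ker \<phi>"
        using kKer y0 by (auto simp: Ker_def blinfun.scaleR_right)
      from norm_add_Ker_eq[OF act y0 this(1), of "a + b * c n"]
        norm_add_Ker_eq[OF act y0 this(2), of "a + b * c n"]
      have "norm ((a + b * c n) *\<^sub>R x0 + b *\<^sub>R k n) = norm ((a + b * c n) *\<^sub>R x0 + (b * norm (k n)) *\<^sub>R y0)"
        using y0 by (simp add: abs_mult)
      ultimately show ?thesis by simp
    qed
    \<comment> \<open>Replacing \<open>T n x\<close> by \<open>x0\<close> costs at most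
      \<open>\<bar>a\<bar> * norm (T n x - x0)\<close>, which tends to 0.\<close>
    have "(\<lambda>n. norm (a *\<^sub>R x + b *\<^sub>R w) - norm (a *\<^sub>R x0 + b *\<^sub>R T n w)) \<longlonglongrightarrow> 0"
    proof (rule Lim_null_comparison)
      show "\<forall>\<^sub>F n in sequentially. norm (norm (a *\<^sub>R x + b *\<^sub>R w) - norm (a *\<^sub>R x0 + b *\<^sub>R T n w))
          \<le> \<bar>a\<bar> * norm (T n x - x0)"
      proof (rule always_eventually, rule allI)
        fix n
        have "norm (a *\<^sub>R x + b *\<^sub>R w) = norm (a *\<^sub>R T n x + b *\<^sub>R T n w)"
          using iso[of n "a *\<^sub>R x + b *\<^sub>R w"] lin[of n] by (simp add: linear_add linear_scale)
        then have "norm (norm (a *\<^sub>R x + b *\<^sub>R w) - norm (a *\<^sub>R x0 + b *\<^sub>R T n w))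
            \<le> norm ((a *\<^sub>R T n x + b *\<^sub>R T n w) - (a *\<^sub>R x0 + b *\<^sub>R T n w))"
          using norm_triangle_ineq3 by (metis real_norm_def)
        also have "\<dots> = norm (a *\<^sub>R (T n x - x0))" by (simp add: algebra_simps)
        finally show "norm (norm (a *\<^sub>R x + b *\<^sub>R w) - norm (a *\<^sub>R x0 + b *\<^sub>R T n w))
            \<le> \<bar>a\<bar> * norm (T n x - x0)" by simp
      qed
      show "(\<lambda>n. \<bar>a\<bar> * norm (T n x - x0)) \<longlonglongrightarrow> 0"
        using tendsto_mult_left[OF tendsto_norm[OF LIM_zero[OF Tx]], of "\<bar>a\<bar>"] by simp
    qed
    then have "(\<lambda>n. norm (a *\<^sub>R x0 + b *\<^sub>R T n w)) \<longlonglongrightarrow> norm (a *\<^sub>R x + b *\<^sub>R w)"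
      using tendsto_diff[OF tendsto_const[of "norm (a *\<^sub>R x + b *\<^sub>R w)"]] by fastforce
    then have "((\<lambda>n. norm (a *\<^sub>R x0 + b *\<^sub>R T n w)) \<circ> r) \<longlonglongrightarrow> norm (a *\<^sub>R x + b *\<^sub>R w)"
      using LIMSEQ_subseq_LIMSEQ r by blast
    moreover have "((\<lambda>n. norm (a *\<^sub>R x0 + b *\<^sub>R T n w)) \<circ> r) \<longlonglongrightarrow> norm ((a + b * c') *\<^sub>R x0 + (b * s) *\<^sub>R y0)"
      unfolding eq o_def using lim unfolding o_def by (intro tendsto_intros)
    ultimately show "norm (a *\<^sub>R x + b *\<^sub>R w) = norm ((a + b * c') *\<^sub>R x0 + (b * s) *\<^sub>R y0)"
      using LIMSEQ_unique by blast
  qed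
qed

section \<open>The plane of \<open>x0\<close> and \<open>y0\<close> is Euclidean\<close>

text \<open>Every unit vector of the plane is carried to \<open>x0\<close> by a linear isometry of
  the plane. The maximal dominated form is invariant under it, hence constant on the unit sphere,
  and homogeneity does the rest.\<close>

lemma norm_plane_quadratic:
  fixes x0 :: "'a::real_normed_vector"
  assumes at: "almost_transitive TYPE('a)"
    and x0: "norm x0 = 1" and supp: "support_functional \<phi> x0"
    and act: "acts_almost_transitively_on_sphere (Stab x0) (Ker \<phi>)"
    and y0: "y0 \<in> Ker \<phi>" "norm y0 = 1"
  obtains Q where "\<And>a b. (norm (a *\<^sub>R x0 + b *\<^sub>R y0))\<^sup>2 = qform Q a b"
proof -
  define N where "N a b = norm (a *\<^sub>R x0 + b *\<^sub>R y0)" for a b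
  have \<phi>: "norm \<phi> = 1" "blinfun_apply \<phi> x0 = 1" "blinfun_apply \<phi> y0 = 0"
    using supp y0 by (auto simp: support_functional_def Ker_def)
  have Na: "\<bar>a\<bar> \<le> N a b" for a b
    using norm_blinfun[of \<phi> "a *\<^sub>R x0 + b *\<^sub>R y0"]
    by (simp add: N_def \<phi> blinfun.add_right blinfun.scaleR_right)
  \<comment> \<open>The factor 2 comes from writing \<open>b *\<^sub>R y0\<close> as the vector
    minus \<open>a *\<^sub>R x0\<close>, with \<open>\<bar>a\<bar>\<close> bounded by
    \<open>Na\<close>.\<close>
  have Nb: "\<bar>b\<bar> \<le> 2 * N a b" for a b
    using norm_triangle_ineq4[of "a *\<^sub>R x0 + b *\<^sub>R y0" "a *\<^sub>R x0"] Na[of a b] x0 y0 by (simp add: N_def)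
  have N0: "a = 0 \<and> b = 0" if "N a b = 0" for a b
    using Na[of a b] Nb[of b a] that by simp
  have Nscale: "N (t * a) (t * b) = \<bar>t\<bar> * N a b" for t a b
    unfolding N_def by (metis norm_scaleR scaleR_add_right scaleR_scaleR)
  \<comment> \<open>The weights give each of \<open>a\<^sup>2 \<le> N\<^sup>2\<close> and
    \<open>b\<^sup>2 \<le> 4 * N\<^sup>2\<close> one half of \<open>N\<^sup>2\<close>. This witness
    makes the maximal determinant positive.\<close>
  have "(1/2, 0, 1/8) \<in> dominated_forms N"
  proof -
    have "a\<^sup>2 / 2 + b\<^sup>2 / 8 \<le> (N a b)\<^sup>2" for a b
    proof -
      have "a\<^sup>2 \<le> (N a b)\<^sup>2" using power_mono[OF Na[of a b], of 2] by simp
      moreover have "b\<^sup>2 \<le> 4 * (N a b)\<^sup>2" using power_mono[OF Nb[of b a], of 2] by (simp add: power_mult_distrib)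
      ultimately show ?thesis by simp
    qed
    then show ?thesis by (simp add: dominated_forms_def qdet_def qform_def)
  qed
  moreover have "continuous_on (dominated_forms N) qdet"
    unfolding qdet_def by (intro continuous_intros)
  ultimately obtain Q where Q: "Q \<in> dominated_forms N"
    and max: "\<And>P. P \<in> dominated_forms N \<Longrightarrow> qdet P \<le> qdet Q"
    using continuous_attains_sup[OF compact_dominated_forms] by (metis empty_iff)
  from max[OF \<open>(1/2, 0, 1/8) \<in> _\<close>] have det: "qdet Q > 0" by (simp add: qdet_def)
  define A where "A = fst Q"
  have "A \<ge> 0" using Q by (simp add: A_def dominated_forms_def)
  have "A > 0"
    using \<open>A \<ge> 0\<close> det unfolding qdet_def A_def
    by (metis diff_gt_0_iff_gt less_eq_real_def mult_zero_left not_less zero_le_power2)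
  have unit: "qform Q p q = A" if pq: "N p q = 1" for p q
  proof -
    define d where "d = p\<^sup>2 + q\<^sup>2"
    have "p \<noteq> 0 \<or> q \<noteq> 0" using pq by (auto simp: N_def)
    then have d: "d > 0" by (simp add: d_def sum_power2_gt_zero_iff)
    \<comment> \<open>The unit vector \<open>(p, q)\<close> is completed to a basis by its quarter
      turn \<open>(-q, p)\<close>.\<close>
    obtain c s where cs: "\<And>a b. norm (a *\<^sub>R (p *\<^sub>R x0 + q *\<^sub>R y0) + b *\<^sub>R ((- q) *\<^sub>R x0 + p *\<^sub>R y0)) =
        norm ((a + b * c) *\<^sub>R x0 + (b * s) *\<^sub>R y0)"
      using norm_plane_eq[OF at x0 supp act y0, of "p *\<^sub>R x0 + q *\<^sub>R y0"] pq
      unfolding N_def by metis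
    have "a *\<^sub>R (p *\<^sub>R x0 + q *\<^sub>R y0) + b *\<^sub>R ((- q) *\<^sub>R x0 + p *\<^sub>R y0) =
        (a * p - b * q) *\<^sub>R x0 + (a * q + b * p) *\<^sub>R y0" for a b
      by (simp add: algebra_simps)
    with cs have cs: "N (a * p - b * q) (a * q + b * p) = N (a + b * c) (b * s)" for a b
      by (simp add: N_def)
    \<comment> \<open>Otherwise \<open>-c\<close> times \<open>(p, q)\<close> plus
      \<open>(-q, p)\<close> would have norm 0, against linear independence.\<close>
    have "s \<noteq> 0"
    proof
      assume "s = 0"
      then have "N (- c * p - 1 * q) (- c * q + 1 * p) = 0"
        using cs[of "- c" 1] by (simp add: N_def)
      from N0[OF this] have "- c * p - q = 0" "- c * q + p = 0" by auto
      then have "q = - c * p" "p = c * q" by auto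
      then have "d = c * q * p - c * p * q" unfolding d_def power2_eq_square
        by (metis (no_types, lifting) diff_conv_add_uminus minus_mult_left)
      then show False using d by simp
    qed
    \<comment> \<open>The matrix sending \<open>(p, q)\<close> to \<open>(1, 0)\<close> and
      \<open>(-q, p)\<close> to \<open>(c, s)\<close>; its determinant is
      \<open>s / d\<close>.\<close>
    define \<alpha> \<beta> \<gamma> \<delta> where "\<alpha> = (p - q * c) / d" "\<beta> = (q + p * c) / d" "\<gamma> = - q * s / d" "\<delta> = p * s / d"
    note defs = this
    have inv: "N (\<alpha> * a + \<beta> * b) (\<gamma> * a + \<delta> * b) = N a b" for a b
    proof -
      \<comment> \<open>The coordinates of \<open>(a, b)\<close> in the basis \<open>(p, q)\<close>,
        \<open>(-q, p)\<close>.\<close>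
      define a' b' where "a' = (p * a + q * b) / d" "b' = (p * b - q * a) / d"
      have "a' + b' * c = \<alpha> * a + \<beta> * b" "b' * s = \<gamma> * a + \<delta> * b"
        unfolding a'_b'_def defs
        by (simp_all add: add_divide_distrib[symmetric] diff_divide_distrib[symmetric] algebra_simps)
      moreover have "a' * p - b' * q = d * a / d" "a' * q + b' * p = d * b / d"
        unfolding a'_b'_def d_def
        by (simp_all add: add_divide_distrib[symmetric] diff_divide_distrib[symmetric] algebra_simps power2_eq_square)
      ultimately show ?thesis using cs[of a' b'] d by simp
    qed
    have "\<alpha> * \<delta> - \<beta> * \<gamma> = s * d / (d * d)"
      unfolding defs d_def
      by (simp add: add_divide_distrib[symmetric] diff_divide_distrib[symmetric] algebra_simps power2_eq_square)
    then have "\<alpha> * \<delta> - \<beta> * \<gamma> \<noteq> 0" using d \<open>s \<noteq> 0\<close> by simp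
    then have "qcomp Q \<alpha> \<beta> \<gamma> \<delta> = Q"
      by (intro max_dominated_form_invariant[where N = N] Q det max inv)
    then have "qform Q p q = qform Q (\<alpha> * p + \<beta> * q) (\<gamma> * p + \<delta> * q)"
      by (simp flip: qform_qcomp)
    moreover have "\<alpha> * p + \<beta> * q = d / d" "\<gamma> * p + \<delta> * q = 0"
      unfolding defs d_def
      by (simp_all add: add_divide_distrib[symmetric] diff_divide_distrib[symmetric] algebra_simps power2_eq_square)
    ultimately show ?thesis using d by (simp add: qform_def A_def)
  qed
  have "(N a b)\<^sup>2 = qform ((1 / A) *\<^sub>R Q) a b" for a b
  proof (cases "N a b = 0")
    case True
    then show ?thesis using N0[OF True] by (simp add: qform_def)
  next
    case False
    define n where "n = N a b"
    have n: "n > 0" using False by (simp add: n_def N_def)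
    have "N (1 / n * a) (1 / n * b) = 1"
      unfolding Nscale using n by (simp add: n_def)
    from unit[OF this] have "n\<^sup>2 * A = n\<^sup>2 * qform Q (1 / n * a) (1 / n * b)" by simp
    also have "\<dots> = qform Q a b" using n by (simp add: qform_def field_simps power2_eq_square)
    finally have "n\<^sup>2 = qform Q a b / A" using \<open>A > 0\<close> by (simp add: field_simps)
    then show ?thesis unfolding n_def[symmetric] by (simp add: qform_def field_simps add_divide_distrib)
  qed
  then show ?thesis using that unfolding N_def by blast
qed

text \<open>The Euclidean form is pulled back from the plane of \<open>x0\<close> and
  \<open>y0\<close>. The cases \<open>x = 0\<close> and \<open>Ker \<phi>\<close> trivial are
  separate: there \<open>x\<close> cannot be normalized, or no \<open>y0\<close> exists.\<close>

lemma norm_combination_quadratic: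
  fixes x0 x w :: "'a::real_normed_vector"
  assumes at: "almost_transitive TYPE('a)"
    and x0: "norm x0 = 1" and supp: "support_functional \<phi> x0"
    and act: "acts_almost_transitively_on_sphere (Stab x0) (Ker \<phi>)"
  obtains Q where "\<And>a b. (norm (a *\<^sub>R x + b *\<^sub>R w))\<^sup>2 = qform Q a b"
proof (cases "x = 0")
  case True
  then show ?thesis
    by (intro that[of "(0, 0, (norm w)\<^sup>2)"]) (simp add: qform_def power_mult_distrib)
next
  case x: False
  have \<phi>: "blinfun_apply \<phi> x0 = 1" using supp by (simp add: support_functional_def)
  show ?thesis
  proof (cases "Ker \<phi> \<subseteq> {0}")
    case True
    have "z = blinfun_apply \<phi> z *\<^sub>R x0" for z
    proof -
      have "z - blinfun_apply \<phi> z *\<^sub>R x0 \<in> Ker \<phi>"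
        by (simp add: Ker_def blinfun.diff_right blinfun.scaleR_right \<phi>)
      then show ?thesis using True by auto
    qed
    then have nz: "norm z = \<bar>blinfun_apply \<phi> z\<bar>" for z
      using x0 by (metis mult.right_neutral norm_scaleR)
    \<comment> \<open>The form is the square of the linear functional \<open>\<phi>\<close> on the
      combination, as the space is one-dimensional.\<close>
    show ?thesis
      by (rule that[of "((blinfun_apply \<phi> x)\<^sup>2, blinfun_apply \<phi> x * blinfun_apply \<phi> w, (blinfun_apply \<phi> w)\<^sup>2)"])
        (simp add: nz qform_def blinfun.add_right blinfun.scaleR_right power2_eq_square algebra_simps)
  next
    case False
    then obtain k where k: "k \<in> Ker \<phi>" "k \<noteq> 0" by blast
    define y0 where "y0 = k /\<^sub>R norm k"
    have y0: "y0 \<in> Ker \<phi>" "norm y0 = 1"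
      using k by (auto simp: y0_def Ker_def blinfun.scaleR_right)
    obtain Q where Q: "\<And>a b. (norm (a *\<^sub>R x0 + b *\<^sub>R y0))\<^sup>2 = qform Q a b"
      using norm_plane_quadratic[OF at x0 supp act y0] by blast
    have "norm (x /\<^sub>R norm x) = 1" using x by simp
    then obtain c s where cs: "\<And>a b. norm (a *\<^sub>R (x /\<^sub>R norm x) + b *\<^sub>R w) =
        norm ((a + b * c) *\<^sub>R x0 + (b * s) *\<^sub>R y0)"
      using norm_plane_eq[OF at x0 supp act y0, of "x /\<^sub>R norm x" w] by blast
    \<comment> \<open>The columns record that \<open>x\<close> goes to
      \<open>norm x *\<^sub>R x0\<close> and \<open>w\<close> to
      \<open>c *\<^sub>R x0 + s *\<^sub>R y0\<close>.\<close>
    have "(norm (a *\<^sub>R x + b *\<^sub>R w))\<^sup>2 = qform (qcomp Q (norm x) c 0 s) a b" for a b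
    proof -
      have "a *\<^sub>R x + b *\<^sub>R w = (norm x * a) *\<^sub>R (x /\<^sub>R norm x) + b *\<^sub>R w" using x by simp
      then show ?thesis by (simp only: cs Q qform_qcomp) (simp add: mult.commute)
    qed
    then show ?thesis by (rule that)
  qed
qed

section \<open>From Euclidean planes to an inner product\<close>

text \<open>The inner product is defined by polarization. A quadratic form on the span of two
  vectors gives homogeneity for all real scalars at once, and the parallelogram law, from which
  additivity follows.\<close>

lemma isometric_to_hilbert_space_if_planes_quadratic:
  assumes quad: "\<And>x w :: 'a::banach. \<exists>Q. \<forall>a b. (norm (a *\<^sub>R x + b *\<^sub>R w))\<^sup>2 = qform Q a b"
  shows "isometric_to_hilbert_space TYPE('a)"
proof -
  define ip :: "'a \<Rightarrow> 'a \<Rightarrow> real" where "ip x y = ((norm (x + y))\<^sup>2 - (norm (x - y))\<^sup>2) / 4" for x y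
  have self: "ip x x = (norm x)\<^sup>2" for x
    by (simp add: ip_def power_mult_distrib flip: scaleR_2)
  have sym: "ip x y = ip y x" for x y
    by (simp add: ip_def add.commute norm_minus_commute)
  have scale: "ip (c *\<^sub>R x) y = c * ip x y" for c x y
  proof -
    obtain Q where "\<And>a b. (norm (a *\<^sub>R x + b *\<^sub>R y))\<^sup>2 = qform Q a b" using quad by blast
    from this[of c 1] this[of c "-1"] this[of 1 1] this[of 1 "-1"] show ?thesis
      by (simp add: ip_def qform_def)
  qed
  have par: "(norm (x + y))\<^sup>2 + (norm (x - y))\<^sup>2 = 2 * (norm x)\<^sup>2 + 2 * (norm y)\<^sup>2" for x y :: 'a
  proof -
    obtain Q where "\<And>a b. (norm (a *\<^sub>R x + b *\<^sub>R y))\<^sup>2 = qform Q a b" using quad by blast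
    from this[of 1 0] this[of 0 1] this[of 1 1] this[of 1 "-1"] show ?thesis
      by (simp add: qform_def)
  qed
  have add: "ip (x + y) z = ip x z + ip y z" for x y z
  proof -
    \<comment> \<open>Doubling \<open>z\<close> makes the parallelogram laws for
      \<open>x + z\<close>, \<open>y + z\<close> and for \<open>x - z\<close>, \<open>y - z\<close>
      applicable; in their difference \<open>norm (x - y)\<close> cancels.\<close>
    have "2 * ip (x + y) z = ip (x + y) (2 *\<^sub>R z)"
      by (metis scale sym)
    moreover have "x + z + (y + z) = x + y + 2 *\<^sub>R z" "x - z + (y - z) = x + y - 2 *\<^sub>R z"
      "(x + z) - (y + z) = x - y" "(x - z) - (y - z) = x - y"
      by (simp_all add: scaleR_2)
    note par[of "x + z" "y + z", unfolded this] par[of "x - z" "y - z", unfolded this]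
    ultimately show ?thesis unfolding ip_def by argo
  qed
  have "inner_product_on UNIV ip"
    unfolding inner_product_on_def using self sym scale add by auto
  \<comment> \<open>The space itself serves as \<open>H\<close>, with \<open>J = id\<close>: the
    induced metric is \<open>dist\<close>, so completeness is that of the Banach space.\<close>
  moreover have "(\<lambda>x y. sqrt (ip (x - y) (x - y))) = dist"
    by (simp add: self dist_norm fun_eq_iff)
  ultimately have "hilbert_space_on UNIV ip"
    by (simp add: hilbert_space_on_def complete_UNIV mcomplete_iff_complete)
  moreover have "linear (id :: 'a \<Rightarrow> 'a)" "range (id :: 'a \<Rightarrow> 'a) = UNIV" by (simp_all add: linear_id)
  ultimately show ?thesis
    unfolding isometric_to_hilbert_space_def using self by (metis id_apply norm_ge_zero real_sqrt_unique)
qed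

theorem theorem2p31:
  fixes x0 :: "'a::banach" and \<phi> :: "'a \<Rightarrow>\<^sub>L real"
  assumes "almost_transitive TYPE('a)"
    and "x0 \<in> sphere 0 1"
    and "support_functional \<phi> x0"
    and "acts_almost_transitively_on_sphere (Stab x0) (Ker \<phi>)"
  shows "isometric_to_hilbert_space TYPE('a)"
proof (rule isometric_to_hilbert_space_if_planes_quadratic)
  fix x w :: 'a
  have "norm x0 = 1" using assms(2) by simp
  then obtain Q where "\<And>a b. (norm (a *\<^sub>R x + b *\<^sub>R w))\<^sup>2 = qform Q a b"
    using norm_combination_quadratic[OF assms(1) _ assms(3,4), of x w] by metis
  then show "\<exists>Q. \<forall>a b. (norm (a *\<^sub>R x + b *\<^sub>R w))\<^sup>2 = qform Q a b" by blast
qed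

end
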